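(* Let $\mathcal H$ be a real Hilbert space. Let $f\in C^1(\mathcal H)$ be real-valued with $\nabla f$ Lipschitz continuous on bounded subsets of $\mathcal H$ and $\inf_{\mathcal H}f>-\infty$, and let $\phi:\mathcal H\to\mathbb R\cup\{+\infty\}$ be proper, lower semicontinuous and convex with $\phi(0)=\min\phi=0$ and $r\mathbb B\subseteq\partial\phi(0)$ for some $r>0$. Suppose $f$ is $\mu$-strongly convex for some $\mu>0$, namely $f(y)\ge f(x)+\langle\nabla f(x),y-x\rangle+\frac\mu2\|y-x\|^2$ for all $x,y\in\mathcal H$. Then $f$ has a unique minimizer $x^*$, and for every $\bar x\in\mathcal H$, $$\|\bar x-x^*\|\le\frac{\|\nabla f(\bar x)\|}{\mu},\qquad 0\le f(\bar x)-f(x^* )\le\frac{\|\nabla f(\bar x)\|^2}{2\mu}.$$ If, in addition, $-\nabla f(\bar x)\in\partial\phi(0)$ and $\partial\phi(0)$ is bounded, with $R_\phi:=\sup\{\|p\|:p\in\partial\phi(0)\}<+\infty$, then $$\|\bar x-x^*\|\le\frac{R_\phi}{\mu},\qquad 0\le f(\bar x)-f(x^* )\le\frac{R_\phi^2}{2\mu}.$$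
   Context: $\mathbb B$ is the closed unit ball of $\mathcal H$ and $\partial\phi$ is the convex subdifferential. *)

theory Defs
  imports "HOL-Analysis.Analysis"
begin

text \<open>
  Functions into \<open>\<real> \<union> {+\<infinity>}\<close> are modelled as \<^typ>\<open>ereal\<close>-valued functions; properness
  excludes the value \<open>-\<infinity>\<close>.
\<close>

definition proper_fun :: "('a \<Rightarrow> ereal) \<Rightarrow> bool" where
  "proper_fun \<phi> \<longleftrightarrow> (\<forall>x. \<phi> x \<noteq> -\<infinity>) \<and> (\<exists>x. \<phi> x \<noteq> \<infinity>)"

definition lower_semicontinuous :: "('a::topological_space \<Rightarrow> ereal) \<Rightarrow> bool" where
  "lower_semicontinuous \<phi> \<longleftrightarrow> (\<forall>x c. c < \<phi> x \<longrightarrow> (\<forall>\<^sub>F y in nhds x. c < \<phi> y))"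

definition convex_fun :: "('a::real_vector \<Rightarrow> ereal) \<Rightarrow> bool" where
  "convex_fun \<phi> \<longleftrightarrow> (\<forall>x y. \<forall>t\<in>{0<..<1::real}.
     \<phi> ((1 - t) *\<^sub>R x + t *\<^sub>R y) \<le> ereal (1 - t) * \<phi> x + ereal t * \<phi> y)"

text \<open>
  For proper \<open>\<phi>\<close> this set is empty wherever \<open>\<phi>\<close> takes the value \<open>+\<infinity>\<close>, as usual.
\<close>

definition subdifferential :: "('a::real_inner \<Rightarrow> ereal) \<Rightarrow> 'a \<Rightarrow> 'a set" where
  "subdifferential \<phi> x = {p. \<forall>y. \<phi> x + ereal (p \<bullet> (y - x)) \<le> \<phi> y}"

end

theory Submission
  imports Defs
begin

text \<open>
  Strong convexity at the midpoint of \<open>x\<close> and \<open>y\<close> bounds \<open>\<parallel>x - y\<parallel>\<^sup>2\<close> by the sum of the two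
  optimality gaps, so minimizing sequences are Cauchy. Testing strong convexity with the minimizer
  and \<open>xb\<close> in both orders, where the gradient vanishes at the minimizer, yields the error
  bounds; \<open>\<phi>\<close> only enters through \<open>\<parallel>grad_f xb\<parallel> \<le> R\<close>.
\<close>

text \<open>Expanding at the midpoint towards the two endpoints uses the opposite displacements
  \<open>d\<close> and \<open>- d\<close>, so the gradient terms cancel on adding. The two quadratic
  terms give \<open>\<mu> * (norm d)\<^sup>2\<close>, where \<open>norm d\<close> is half of
  \<open>norm (x - y)\<close>.\<close>

lemma strongly_convex_midpoint:
  fixes f :: "'a::real_inner \<Rightarrow> real"
  assumes sc: "\<And>x y. f y \<ge> f x + g x \<bullet> (y - x) + \<mu> / 2 * (norm (y - x))\<^sup>2"
  shows "2 * f ((1/2) *\<^sub>R (x + y)) + \<mu> / 4 * (norm (x - y))\<^sup>2 \<le> f x + f y"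
proof -
  define z where "z = (1/2) *\<^sub>R (x + y)"
  define d where "d = (1/2) *\<^sub>R (x - y)"
  have x: "x - z = d" and y: "y - z = - d"
    by (simp_all add: z_def d_def scaleR_add_right scaleR_diff_right algebra_simps
        flip: scaleR_add_left)
  have "\<mu> / 4 * (norm (x - y))\<^sup>2 = \<mu> * (norm d)\<^sup>2"
    by (simp add: d_def power_divide)
  moreover have "f x \<ge> f z + g z \<bullet> d + \<mu> / 2 * (norm d)\<^sup>2"
    using sc[of z x] by (simp add: x)
  moreover have "f y \<ge> f z - g z \<bullet> d + \<mu> / 2 * (norm d)\<^sup>2"
    using sc[of z y] by (simp add: y)
  ultimately show ?thesis
    unfolding z_def[symmetric] by linarith
qed

text \<open>Completeness takes the place of compactness: a minimizing sequence converges, and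
  continuity makes its limit a minimizer. The estimate \<open>gap\<close> gives both the Cauchy
  property and uniqueness.\<close>

lemma strongly_convex_ex1_minimizer:
  fixes f :: "'a::{real_inner, complete_space} \<Rightarrow> real"
  assumes "\<mu> > 0" and cont: "continuous_on UNIV f" and bdd: "bdd_below (range f)"
    and sc: "\<And>x y. f y \<ge> f x + g x \<bullet> (y - x) + \<mu> / 2 * (norm (y - x))\<^sup>2"
  shows "\<exists>!xs. \<forall>y. f xs \<le> f y"
proof -
  define m where "m = Inf (range f)"
  have m: "m \<le> f x" for x
    using bdd by (auto simp: m_def intro: cInf_lower)
  have gap: "\<mu> / 4 * (norm (x - y))\<^sup>2 \<le> (f x - m) + (f y - m)" for x y
    using strongly_convex_midpoint[of f g \<mu> x y, OF sc] m[of "(1/2) *\<^sub>R (x + y)"] by linarith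
  have "\<exists>x. f x < m + inverse (real (Suc n))" for n
    using cInf_lessD[of "range f" "m + inverse (real (Suc n))"] by (auto simp: m_def)
  then obtain X where X: "\<And>n. f (X n) < m + inverse (real (Suc n))"
    by metis
  have "Cauchy X"
  proof (rule metric_CauchyI)
    fix e :: real assume "e > 0"
    \<comment> \<open>The constant is half of the factor \<mu>/4 in \<open>gap\<close>, because the
      gaps of two terms of the sequence are added there.\<close>
    then have "\<mu> / 8 * e\<^sup>2 > 0" using \<open>\<mu> > 0\<close> by simp
    then obtain N where N: "inverse (real (Suc N)) < \<mu> / 8 * e\<^sup>2"
      using reals_Archimedean by blast
    have small: "f (X n) - m < \<mu> / 8 * e\<^sup>2" if "n \<ge> N" for n
    proof -
      have "inverse (real (Suc n)) \<le> inverse (real (Suc N))"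
        using that by (intro le_imp_inverse_le) auto
      with X[of n] N show ?thesis by linarith
    qed
    have "dist (X i) (X j) < e" if "i \<ge> N" "j \<ge> N" for i j
    proof -
      have "\<mu> / 4 * (norm (X i - X j))\<^sup>2 < \<mu> / 4 * e\<^sup>2"
        using gap[of "X i" "X j"] small[OF that(1)] small[OF that(2)] by linarith
      then have "(norm (X i - X j))\<^sup>2 < e\<^sup>2" using \<open>\<mu> > 0\<close> by simp
      then show ?thesis
        using \<open>e > 0\<close> by (simp add: dist_norm power2_less_imp_less)
    qed
    then show "\<exists>N. \<forall>i\<ge>N. \<forall>j\<ge>N. dist (X i) (X j) < e" by blast
  qed
  then obtain a where a: "X \<longlonglongrightarrow> a"
    using Cauchy_convergent convergent_def by blast
  have "(\<lambda>n. f (X n)) \<longlonglongrightarrow> f a"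
    by (rule continuous_on_tendsto_compose[OF cont a]) auto
  moreover have "(\<lambda>n. m + inverse (real (Suc n))) \<longlonglongrightarrow> m"
    using LIMSEQ_inverse_real_of_nat_add[of m] .
  ultimately have "f a \<le> m"
    by (rule LIMSEQ_le) (use X in \<open>auto intro: less_imp_le\<close>)
  show ?thesis
  proof (rule ex1I[of _ a])
    show "\<forall>y. f a \<le> f y" using \<open>f a \<le> m\<close> m order_trans by blast
    \<comment> \<open>Both \<open>a\<close> and \<open>b\<close> attain the infimum
      \<open>m\<close>, so the right-hand side of \<open>gap\<close> is at most zero.\<close>
    fix b assume "\<forall>y. f b \<le> f y"
    then have "f b \<le> m" using \<open>f a \<le> m\<close> order_trans by blast
    then have "\<mu> / 4 * (norm (b - a))\<^sup>2 \<le> 0"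
      using gap[of b a] \<open>f a \<le> m\<close> by linarith
    then show "b = a" using \<open>\<mu> > 0\<close> by (simp add: mult_le_0_iff)
  qed
qed

text \<open>The derivative at a minimizer is the zero functional; evaluating it at \<open>g\<close>
  itself gives \<open>g \<bullet> g = 0\<close>.\<close>

lemma GDERIV_minimum_eq_0:
  assumes "GDERIV f x :> g" and "\<And>y. f x \<le> f y"
  shows "g = 0"
proof -
  have "(\<lambda>h. h \<bullet> g) = (\<lambda>h. 0)"
    using assms by (intro has_derivative_local_min[of f _ x]) (auto simp: gderiv_def)
  then have "g \<bullet> g = 0" by metis
  then show ?thesis by simp
qed

lemma strongly_convex_error_bounds:
  fixes f :: "'a::real_inner \<Rightarrow> real"
  assumes "\<mu> > 0" and "g xs = 0"
    and sc: "\<And>x y. f y \<ge> f x + g x \<bullet> (y - x) + \<mu> / 2 * (norm (y - x))\<^sup>2"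
  shows "norm (x - xs) \<le> norm (g x) / \<mu>"
    and "f x - f xs \<le> (norm (g x))\<^sup>2 / (2 * \<mu>)"
proof -
  define d where "d = norm (x - xs)"
  have "- (g x \<bullet> (xs - x)) \<le> norm (g x) * d"
    using norm_cauchy_schwarz[of "g x" "x - xs"] by (simp add: d_def inner_diff_right)
  then have upper: "f x - f xs \<le> norm (g x) * d - \<mu> / 2 * d\<^sup>2"
    using sc[of x xs] by (simp add: d_def norm_minus_commute)
  have "f x - f xs \<ge> \<mu> / 2 * d\<^sup>2"
    using sc[of xs x] \<open>g xs = 0\<close> by (simp add: d_def)
  \<comment> \<open>The lower bound comes from expanding at \<open>xs\<close>, the upper one from
    expanding at \<open>x\<close> with Cauchy-Schwarz. Comparing them leaves a common factor
    \<open>d\<close> to cancel, the case \<open>d = 0\<close> being trivial.\<close>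
  with upper have "\<mu> * d * d \<le> norm (g x) * d"
    by (simp add: power2_eq_square)
  moreover have "d \<ge> 0" by (simp add: d_def)
  ultimately have "\<mu> * d \<le> norm (g x)"
    by (cases "d = 0") (auto simp: mult_le_cancel_right)
  then show "norm (x - xs) \<le> norm (g x) / \<mu>"
    using \<open>\<mu> > 0\<close> by (simp add: d_def field_simps)
  \<comment> \<open>Completing the square in \<open>d\<close> bounds the upper estimate by its
    maximum, independently of the distance.\<close>
  have "norm (g x) * d - \<mu> / 2 * d\<^sup>2 = (norm (g x))\<^sup>2 / (2 * \<mu>) - (norm (g x) - \<mu> * d)\<^sup>2 / (2 * \<mu>)"
    using \<open>\<mu> > 0\<close> by (simp add: field_simps power2_eq_square)
  also have "\<dots> \<le> (norm (g x))\<^sup>2 / (2 * \<mu>)"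
    using \<open>\<mu> > 0\<close> by simp
  finally show "f x - f xs \<le> (norm (g x))\<^sup>2 / (2 * \<mu>)"
    using upper by linarith
qed

theorem proposition4p8:
  fixes f :: "'a::{real_inner, complete_space} \<Rightarrow> real"
    and grad_f :: "'a \<Rightarrow> 'a"
    and \<phi> :: "'a \<Rightarrow> ereal"
    and r \<mu> :: real
  assumes "\<And>x. GDERIV f x :> grad_f x"
    and "continuous_on UNIV grad_f"
    and "\<And>B. bounded B \<Longrightarrow> \<exists>L. L-lipschitz_on B grad_f"
    and "bdd_below (range f)"
    and "proper_fun \<phi>" and "lower_semicontinuous \<phi>" and "convex_fun \<phi>"
    and "\<phi> 0 = 0" and "\<And>x. \<phi> 0 \<le> \<phi> x"
    and "r > 0" and "cball 0 r \<subseteq> subdifferential \<phi> 0"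
    and "\<mu> > 0"
    and "\<And>x y. f y \<ge> f x + grad_f x \<bullet> (y - x) + \<mu> / 2 * (norm (y - x))\<^sup>2"
  shows "(\<exists>!xs. is_arg_min f (\<lambda>_. True) xs) \<and>
    (\<forall>xs. is_arg_min f (\<lambda>_. True) xs \<longrightarrow>
      (\<forall>xb. norm (xb - xs) \<le> norm (grad_f xb) / \<mu> \<and>
            0 \<le> f xb - f xs \<and>
            f xb - f xs \<le> (norm (grad_f xb))\<^sup>2 / (2 * \<mu>) \<and>
            (- grad_f xb \<in> subdifferential \<phi> 0 \<and> bounded (subdifferential \<phi> 0) \<longrightarrow>
              (let R = (SUP p\<in>subdifferential \<phi> 0. norm p) in
                norm (xb - xs) \<le> R / \<mu> \<and>
                0 \<le> f xb - f xs \<and>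
                f xb - f xs \<le> R\<^sup>2 / (2 * \<mu>)))))"
proof -
  note sc = assms(13)
  have "isCont f x" for x
    using assms(1)[of x] unfolding gderiv_def by (rule has_derivative_continuous)
  then have "continuous_on UNIV f"
    by (simp add: continuous_at_imp_continuous_on)
  then have "\<exists>!xs. \<forall>y. f xs \<le> f y"
    using strongly_convex_ex1_minimizer[of \<mu> f grad_f] assms(4,12) sc by blast
  moreover have "norm (xb - xs) \<le> norm (grad_f xb) / \<mu>"
    "0 \<le> f xb - f xs" "f xb - f xs \<le> (norm (grad_f xb))\<^sup>2 / (2 * \<mu>)"
    if "\<forall>y. f xs \<le> f y" for xs xb
  proof -
    have "grad_f xs = 0"
      using assms(1) that by (blast intro: GDERIV_minimum_eq_0)
    note bounds = strongly_convex_error_bounds[where f = f, OF \<open>\<mu> > 0\<close> this sc]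
    show "norm (xb - xs) \<le> norm (grad_f xb) / \<mu>" by (rule bounds)
    show "f xb - f xs \<le> (norm (grad_f xb))\<^sup>2 / (2 * \<mu>)" by (rule bounds)
    show "0 \<le> f xb - f xs" using that by simp
  qed
  moreover have "norm (grad_f xb) / \<mu> \<le> R / \<mu>" "(norm (grad_f xb))\<^sup>2 / (2 * \<mu>) \<le> R\<^sup>2 / (2 * \<mu>)"
    if "- grad_f xb \<in> subdifferential \<phi> 0" "bounded (subdifferential \<phi> 0)"
      and R: "R = (SUP p\<in>subdifferential \<phi> 0. norm p)" for xb R
  proof -
    \<comment> \<open>A real-valued \<open>SUP\<close> is known to dominate its members only once
      the set is bounded above. Membership of \<open>- grad_f xb\<close> then suffices, as the norm
      ignores the sign.\<close>
    have "bdd_above (norm ` subdifferential \<phi> 0)"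
      using that(2) by (auto simp: bounded_iff bdd_above_def)
    then have "norm (grad_f xb) \<le> R"
      using cSUP_upper[OF that(1), of norm] by (simp add: R)
    then show "norm (grad_f xb) / \<mu> \<le> R / \<mu>" "(norm (grad_f xb))\<^sup>2 / (2 * \<mu>) \<le> R\<^sup>2 / (2 * \<mu>)"
      using \<open>\<mu> > 0\<close> by (auto intro!: divide_right_mono power_mono)
  qed
  \<comment> \<open>Over a linear order \<open>is_arg_min\<close> unfolds to the pointwise
    inequality used above; the bounds in \<open>R\<close> follow from the gradient bounds by
    transitivity.\<close>
  ultimately show ?thesis
    unfolding is_arg_min_linorder Let_def by (simp, meson order_trans)
qed

end
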